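(* Let $p\equiv 1\pmod 4$ be a prime. Let $X=\{(a,b)\in V\times V : a<b<\overline{a}<\overline{b}\}$, $Y=\{(a,b)\in V\times V : a<\overline{a}<b<\overline{b}\}$, $Z=\{(a,b)\in V\times V : a<b<\overline{b}<\overline{a}\}$. Then $|X|=|Y|=|Z|=(p-1)(p-5)/96$.
   Context: For an integer $x$, $\{x\}_p$ denotes the least nonnegative residue of $x$ modulo $p$, and $\widetilde{x}=p-\{x\}_p$ if $\{x\}_p>p/2$, while $\widetilde{x}=\{x\}_p$ if $\{x\}_p<p/2$. Let $t=\prod_{x=1}^{(p-1)/2}x$ (so $t^2\equiv-1\pmod p$). Let $V=\{x : 1\le x\le (p-1)/2,\ x<\widetilde{tx}\}$, and for $a\in V$ put $\overline{a}=\widetilde{ta}$; the pairs $(a,\overline{a})$, $a\in V$, partition $\{1,\ldots,(p-1)/2\}$. *)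

theory Defs
  imports Complex_Main "HOL-Number_Theory.Cong" "HOL-Computational_Algebra.Primes"
begin

text \<open>
  \<open>tilde p x\<close> is the distance from the integer \<open>x\<close> to the nearest multiple of \<open>p\<close>. Only odd \<open>p\<close>
  are of interest, so the residue is never equal to \<open>p / 2\<close>.
\<close>

definition tilde :: "int \<Rightarrow> int \<Rightarrow> int" where
  "tilde p x = (if real_of_int (x mod p) > real_of_int p / 2 then p - x mod p else x mod p)"

definition tval :: "int \<Rightarrow> int" where
  "tval p = \<Prod>{1..(p - 1) div 2}"

definition pbar :: "int \<Rightarrow> int \<Rightarrow> int" where
  "pbar p a = tilde p (tval p * a)"

definition V :: "int \<Rightarrow> int set" where
  "V p = {x. 1 \<le> x \<and> x \<le> (p - 1) div 2 \<and> x < tilde p (tval p * x)}"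

definition X :: "int \<Rightarrow> (int \<times> int) set" where
  "X p = {(a, b) \<in> V p \<times> V p. a < b \<and> b < pbar p a \<and> pbar p a < pbar p b}"

definition Y :: "int \<Rightarrow> (int \<times> int) set" where
  "Y p = {(a, b) \<in> V p \<times> V p. a < pbar p a \<and> pbar p a < b \<and> b < pbar p b}"

definition Z :: "int \<Rightarrow> (int \<times> int) set" where
  "Z p = {(a, b) \<in> V p \<times> V p. a < b \<and> b < pbar p b \<and> pbar p b < pbar p a}"

end

theory Submission
  imports Defs "HOL-Number_Theory.Residues"
begin

text \<open>
  Let \<open>n = (p - 1) / 2\<close> and regard each pair \<open>(a, bar a)\<close>, \<open>a \<in> V\<close>, as a chord on the points
  \<open>1, \<dots>, n\<close>. Two chords cross (\<open>X\<close>), are disjoint (\<open>Y\<close>) or are nested (\<open>Z\<close>), which gives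
  \<open>|X| + |Y| + |Z| = n (n - 2) / 8\<close>.

  The sum of \<open>sgn (y - x) sgn (y - bar x)\<close> over all points \<open>x, y\<close> is \<open>8 |Y|\<close>; for fixed \<open>x\<close> the
  inner sum is \<open>n - 2 |bar x - x|\<close>. Since \<open>a \<mapsto> bar a - a\<close> permutes \<open>V\<close>, the \<open>bar a\<close> sum to twice
  the sum of the \<open>a\<close>, and \<open>|Y| = n (n - 2) / 24\<close> follows.

  The sum of \<open>sgn (y - x) sgn (bar y - bar x)\<close> is \<open>8 (|Y| - |Z|) - n\<close>. Extended to all residues
  and rewritten in the coordinates \<open>x = v - u\<close>, \<open>y = v + u\<close>, it becomes the square of the sum of
  \<open>\<sigma> (u) \<sigma> (t u)\<close>, where \<open>\<sigma>\<close> is the sign of the centred residue. That sum changes sign under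
  \<open>u \<mapsto> t u\<close>, so it vanishes, and accounting for the terms with \<open>x = 0\<close> or \<open>y = 0\<close> gives
  \<open>|Y| = |Z|\<close>.
\<close>

text \<open>For odd \<open>p\<close>, the representative of least absolute value. It keeps the sign
  that \<open>tilde\<close> forgets.\<close>

definition cres :: "int \<Rightarrow> int \<Rightarrow> int" where
  "cres p x = (x + (p - 1) div 2) mod p - (p - 1) div 2"

text \<open>Extends the order on 1, ..., (p - 1) / 2 to all residues; passing through
  \<open>tilde\<close> makes it periodic and even in both arguments.\<close>

definition cmp :: "int \<Rightarrow> int \<Rightarrow> int \<Rightarrow> int" where
  "cmp p x y = sgn (tilde p y - tilde p x)"

section \<open>Auxiliary sums over residues and intervals\<close>

lemma sum_residues_affine:
  fixes g :: "int \<Rightarrow> int"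
  assumes "0 < p" and "coprime c p" and periodic: "\<And>x. g (x mod p) = g x"
  shows "(\<Sum>x\<in>{0..<p}. g (c * x + d)) = (\<Sum>x\<in>{0..<p}. g x)"
proof -
  let ?h = "\<lambda>x. (c * x + d) mod p"
  have inj: "inj_on ?h {0..<p}"
  proof (rule inj_onI)
    fix x y assume xy: "x \<in> {0..<p}" "y \<in> {0..<p}" "?h x = ?h y"
    then have "[c * x = c * y] (mod p)"
      by (metis cong_add_rcancel cong_def)
    then have "[x = y] (mod p)"
      using assms(2) by (simp add: cong_mult_lcancel)
    then show "x = y"
      using xy by (simp add: cong_def)
  qed
  moreover have "?h ` {0..<p} \<subseteq> {0..<p}"
    using assms(1) by auto
  ultimately have "?h ` {0..<p} = {0..<p}"
    by (simp add: endo_inj_surj)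
  then have "(\<Sum>x\<in>{0..<p}. g x) = (\<Sum>x\<in>{0..<p}. g (?h x))"
    using sum.reindex[OF inj, of g] by simp
  then show ?thesis
    by (simp add: periodic)
qed

text \<open>The terms are 1 outside the chord, -1 at its z - x - 1 interior points and 0 at its two
  ends.\<close>

lemma sum_sgn_mult_sgn:
  fixes x z n :: int
  assumes "1 \<le> x" "x < z" "z \<le> n"
  shows "(\<Sum>y\<in>{1..n}. sgn (y - x) * sgn (y - z)) = n - 2 * (z - x)"
proof -
  let ?g = "\<lambda>y. sgn (y - x) * sgn (y - z)"
  have split: "{1..n} = ({1..<x} \<union> {z<..n}) \<union> {x<..<z} \<union> {x, z}"
    using assms by auto
  have "sum ?g {1..n} = sum ?g ({1..<x} \<union> {z<..n}) + sum ?g {x<..<z} + sum ?g {x, z}"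
    unfolding split using assms by (subst sum.union_disjoint; auto)+
  moreover have "sum ?g ({1..<x} \<union> {z<..n}) = sum (\<lambda>_. 1) ({1..<x} \<union> {z<..n})"
    using assms by (intro sum.cong) auto
  moreover have "sum ?g {x<..<z} = sum (\<lambda>_. -1) {x<..<z}"
    by (intro sum.cong) auto
  moreover have "card ({1..<x} \<union> {z<..n}) = nat (x - 1) + nat (n - z)"
    by (subst card_Un_disjoint) (use assms in auto)
  ultimately show ?thesis
    using assms by auto
qed

section \<open>Centred residues and \<open>tilde\<close> for an odd modulus\<close>

locale odd_modulus =
  fixes p n :: int
  assumes p_eq: "p = 2 * n + 1" and n_pos: "0 < n"
begin

abbreviation sg :: "int \<Rightarrow> int" where "sg x \<equiv> sgn (cres p x)"

lemma half: "(p - 1) div 2 = n"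
  using p_eq by simp

lemma cres_bounds: "- n \<le> cres p x" "cres p x \<le> n"
  using p_eq n_pos pos_mod_bound[of p "x + n"] pos_mod_sign[of p "x + n"]
  unfolding cres_def half by linarith+

lemma cres_unique:
  assumes "p dvd x - r" "\<bar>r\<bar> \<le> n"
  shows "cres p x = r"
proof -
  have "(x + n) mod p = (r + n) mod p"
    using assms(1) by (simp add: mod_eq_dvd_iff)
  also have "\<dots> = r + n"
    using assms(2) p_eq by (intro mod_pos_pos_trivial) auto
  finally show ?thesis
    unfolding cres_def half by simp
qed

lemma dvd_diff_cres: "p dvd x - cres p x"
proof -
  have "p dvd (x + n) - (x + n) mod p"
    by (rule dvd_minus_mod)
  then show ?thesis
    unfolding cres_def half by (simp add: algebra_simps)
qed

lemma cres_cong: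
  assumes "p dvd x - y"
  shows "cres p x = cres p y"
proof (rule cres_unique)
  show "p dvd x - cres p y"
    using dvd_add[OF assms dvd_diff_cres[of y]] by simp
  show "\<bar>cres p y\<bar> \<le> n"
    using cres_bounds[of y] by auto
qed

lemma cres_minus: "cres p (- x) = - cres p x"
proof (rule cres_unique)
  show "p dvd - x - - cres p x"
    using dvd_diff_cres[of x] by (simp add: dvd_diff_commute)
  show "\<bar>- cres p x\<bar> \<le> n"
    using cres_bounds[of x] by auto
qed

lemma cres_small: "\<bar>x\<bar> \<le> n \<Longrightarrow> cres p x = x"
  by (rule cres_unique) auto

lemma cres_mod: "cres p (x mod p) = cres p x"
  by (rule cres_cong) (simp add: dvd_diff_commute)

lemma tilde_eq_abs_cres: "tilde p x = \<bar>cres p x\<bar>"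
proof -
  define r where "r = x mod p"
  have "0 < p"
    using p_eq n_pos by simp
  then have r: "0 \<le> r" "r < p"
    by (simp_all add: r_def)
  have t: "tilde p x = (if r > n then p - r else r)"
  proof -
    have "real_of_int r > real_of_int p / 2 \<longleftrightarrow> 2 * r > p"
      by linarith
    then show ?thesis
      using p_eq unfolding tilde_def r_def[symmetric] by auto
  qed
  have "cres p x = cres p r"
    by (simp add: r_def cres_mod)
  also have "\<dots> = (if r > n then r - p else r)"
    using r p_eq by (intro cres_unique) auto
  finally show ?thesis
    using t r by auto
qed

lemma tilde_bounds: "0 \<le> tilde p x" "tilde p x \<le> n"
  using cres_bounds[of x] by (auto simp: tilde_eq_abs_cres)

lemma tilde_cong: "p dvd x - y \<Longrightarrow> tilde p x = tilde p y"
  using cres_cong by (simp add: tilde_eq_abs_cres)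

lemma tilde_minus [simp]: "tilde p (- x) = tilde p x"
  by (simp add: tilde_eq_abs_cres cres_minus)

lemma tilde_small: "0 \<le> x \<Longrightarrow> x \<le> n \<Longrightarrow> tilde p x = x"
  by (simp add: tilde_eq_abs_cres cres_small)

lemma tilde_large:
  assumes "n < x" "x \<le> 2 * n"
  shows "tilde p x = p - x"
proof -
  have "tilde p x = tilde p (- (p - x))"
    by (rule tilde_cong) simp
  also have "\<dots> = p - x"
    unfolding tilde_minus using assms p_eq by (intro tilde_small) auto
  finally show ?thesis .
qed

lemma tilde_signed: obtains e where "e = 1 \<or> e = -1" "p dvd tilde p x - e * x"
proof (cases "0 \<le> cres p x")
  case True
  then show ?thesis
    using dvd_diff_cres[of x] that[of 1] by (simp add: tilde_eq_abs_cres dvd_diff_commute)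
next
  case False
  then show ?thesis
    using dvd_diff_cres[of x] that[of "-1"] by (simp add: tilde_eq_abs_cres)
qed

lemma tilde_mult_tilde: "tilde p (c * tilde p x) = tilde p (c * x)"
proof -
  obtain e where e: "e = 1 \<or> e = -1" "p dvd tilde p x - e * x"
    by (rule tilde_signed)
  have "p dvd c * tilde p x - c * (e * x)"
    using e(2) by (metis dvd_mult right_diff_distrib)
  then have "tilde p (c * tilde p x) = tilde p (c * (e * x))"
    by (rule tilde_cong)
  then show ?thesis
    using e(1) by auto
qed

lemma tilde_mod: "tilde p (x mod p) = tilde p x"
  by (simp add: tilde_eq_abs_cres cres_mod)

text \<open>
  Rotating coordinates by 45 degrees turns comparison of absolute residues into a product of signs.
\<close>

lemma cmp_diff_add: "cmp p (v - u) (v + u) = sg u * sg v"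
proof -
  define a b where "a = cres p u" and "b = cres p v"
  have ab: "- n \<le> a" "a \<le> n" "- n \<le> b" "b \<le> n"
    using cres_bounds by (auto simp: a_def b_def)
  have "p dvd (v - u) - (b - a)" "p dvd (v + u) - (b + a)"
    using dvd_add[OF dvd_diff_cres[of v] dvd_diff_cres[of u]]
      dvd_diff[OF dvd_diff_cres[of v] dvd_diff_cres[of u]]
    by (simp_all add: a_def b_def algebra_simps)
  then have 1: "tilde p (v - u) = tilde p (b - a)" "tilde p (v + u) = tilde p (b + a)"
    by (auto intro: tilde_cong)
  have 2: "tilde p w = (if \<bar>w\<bar> \<le> n then \<bar>w\<bar> else p - \<bar>w\<bar>)" if "\<bar>w\<bar> \<le> 2 * n" for w
    using tilde_small[of "\<bar>w\<bar>"] tilde_large[of "\<bar>w\<bar>"] tilde_minus[of w] that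
    by (cases "0 \<le> w") auto
  have 3: "tilde p (b - a) = (if \<bar>b - a\<bar> \<le> n then \<bar>b - a\<bar> else p - \<bar>b - a\<bar>)"
    "tilde p (b + a) = (if \<bar>b + a\<bar> \<le> n then \<bar>b + a\<bar> else p - \<bar>b + a\<bar>)"
    using ab by (intro 2; linarith)+
  \<comment> \<open>For equal signs, |b - a| is less than |b + a|, and the two add up to 2 max(|a|,
    |b|) \<le> 2 * n < p. So |b - a| is also less than p - |b + a|, and folding at p / 2 cannot
    reverse the comparison.\<close>
  have pos: "tilde p (b - a) < tilde p (b + a)" if "0 < a \<and> 0 < b \<or> a < 0 \<and> b < 0"
    using that ab p_eq unfolding 3 by (smt (verit))
  have neg: "tilde p (b + a) < tilde p (b - a)" if "0 < a \<and> b < 0 \<or> a < 0 \<and> 0 < b"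
    using that ab p_eq unfolding 3 by (smt (verit))
  have "tilde p (b + a) = tilde p (b - a)" if "a = 0 \<or> b = 0"
    using that tilde_minus[of a] by auto
  then have "sgn (tilde p (b + a) - tilde p (b - a)) = sgn a * sgn b"
    using pos neg
    by (cases a "0 :: int" rule: linorder_cases; cases b "0 :: int" rule: linorder_cases) simp_all
  then show ?thesis
    by (simp add: cmp_def 1 a_def b_def)
qed

text \<open>The residues n + 1, ..., 2n are the negatives of 1, ..., n.\<close>

lemma sum_residues_even:
  fixes g :: "int \<Rightarrow> int"
  assumes periodic: "\<And>x. g (x mod p) = g x" and even: "\<And>x. g (- x) = g x"
  shows "(\<Sum>x\<in>{0..<p}. g x) = g 0 + 2 * (\<Sum>x\<in>{1..n}. g x)"
proof -
  have split: "{0..<p} = insert 0 ({1..n} \<union> {n + 1..2 * n})"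
    using p_eq n_pos by auto
  have "(\<Sum>x\<in>{n + 1..2 * n}. g x) = (\<Sum>x\<in>{1..n}. g (p - x))"
    by (rule sum.reindex_bij_witness[where i = "\<lambda>x. p - x" and j = "\<lambda>x. p - x"])
      (use p_eq in auto)
  also have "\<dots> = (\<Sum>x\<in>{1..n}. g x)"
  proof (rule sum.cong)
    fix x
    show "g (p - x) = g x"
      using periodic[of "p - x"] periodic[of "- x"] even[of x] by simp
  qed simp
  finally show ?thesis
    unfolding split by (simp add: sum.union_disjoint)
qed

end

section \<open>The square root \<open>t\<close> of -1 and the involution \<open>bar\<close>\<close>

lemma prod_atLeastAtMost_int: "\<Prod>{1..int k} = fact k"
proof (induction k)
  case (Suc k)
  have "{1..int (Suc k)} = insert (int (Suc k)) {1..int k}"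
    by auto
  then show ?case
    using Suc by simp
qed simp

lemma sum_atLeastAtMost_int: "2 * \<Sum>{1..int k} = int k * (int k + 1)"
proof (induction k)
  case (Suc k)
  have "{1..int (Suc k)} = insert (int (Suc k)) {1..int k}"
    by auto
  then show ?case
    using Suc by (simp add: algebra_simps)
qed simp

locale prime_1_mod_4 = odd_modulus +
  assumes prime: "prime p" and even_n: "even n"
begin

abbreviation t :: int where "t \<equiv> tval p"
abbreviation bar :: "int \<Rightarrow> int" where "bar \<equiv> pbar p"

lemma p_ge_5: "5 \<le> p"
  using p_eq n_pos even_n by presburger

text \<open>By Wilson, (2n)! is -1 modulo \<open>p\<close>. The factors above \<open>n\<close> are p
  - x for x = 1, ..., n, so their product is (-1)^n t, which is \<open>t\<close> because
  \<open>n\<close> is even.\<close>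

lemma t_sq: "p dvd t * t + 1"
proof -
  have "prime (nat p)"
    using prime prime_int_nat_transfer by blast
  then have "[fact (nat p - 1) = (-1 :: int)] (mod int (nat p))"
    by (rule wilson_theorem)
  moreover have "int (nat p) = p" "nat p - 1 = nat (2 * n)"
    using p_eq n_pos by auto
  ultimately have wilson: "[\<Prod>{1..2 * n} = -1] (mod p)"
    using prod_atLeastAtMost_int[of "nat (2 * n)"] n_pos by simp
  have "\<Prod>{1..2 * n} = \<Prod>{1..n} * \<Prod>{n + 1..2 * n}"
    using n_pos by (subst prod.union_disjoint[symmetric]) (auto intro!: prod.cong)
  also have "\<Prod>{n + 1..2 * n} = (\<Prod>x\<in>{1..n}. p - x)"
    by (rule prod.reindex_bij_witness[where i = "\<lambda>x. p - x" and j = "\<lambda>x. p - x"])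
      (use p_eq in auto)
  finally have split: "\<Prod>{1..2 * n} = t * (\<Prod>x\<in>{1..n}. p - x)"
    unfolding tval_def half .
  have "[(\<Prod>x\<in>{1..n}. p - x) = (\<Prod>x\<in>{1..n}. - x)] (mod p)"
    by (intro cong_prod) (simp add: cong_iff_dvd_diff)
  also have "(\<Prod>x\<in>{1..n}. - x) = (-1) ^ nat n * t"
    using prod.distrib[of "\<lambda>_. -1" "\<lambda>x. x" "{1..n}"] unfolding tval_def half by simp
  also have "\<dots> = t"
    using even_n n_pos by (simp add: even_nat_iff)
  finally have "[t * (\<Prod>x\<in>{1..n}. p - x) = t * t] (mod p)"
    by (rule cong_scalar_left)
  then have "[t * t = -1] (mod p)"
    using wilson unfolding split by (metis cong_sym cong_trans)
  then show ?thesis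
    by (simp add: cong_iff_dvd_diff)
qed

lemma coprime_t: "coprime t p"
proof -
  have "\<not> p dvd t"
  proof
    assume "p dvd t"
    then have "p dvd t * t"
      by simp
    then have "p dvd 1"
      using t_sq dvd_add_right_iff by blast
    then show False
      using p_ge_5 by simp
  qed
  then show ?thesis
    using prime by (simp add: prime_imp_coprime coprime_commute)
qed

lemma bar_bar:
  assumes "x \<in> {1..n}"
  shows "bar (bar x) = x"
proof -
  have "p dvd t * (t * x) - - x"
    using dvd_mult2[OF t_sq, of x] by (simp add: algebra_simps)
  then have "tilde p (t * (t * x)) = tilde p x"
    using tilde_cong by (metis tilde_minus)
  then show ?thesis
    using assms by (simp add: pbar_def tilde_mult_tilde tilde_small)
qed

lemma bar_in: "x \<in> {1..n} \<Longrightarrow> bar x \<in> {1..n}"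
proof -
  assume x: "x \<in> {1..n}"
  have "bar x \<noteq> 0"
  proof
    assume "bar x = 0"
    then have "bar (bar x) = 0"
      using n_pos by (simp add: pbar_def tilde_small)
    then show False
      using bar_bar[OF x] x by simp
  qed
  then show ?thesis
    using tilde_bounds[of "t * x"] by (auto simp: pbar_def)
qed

text \<open>Multiplying the first congruence by \<open>t\<close> and using t^2 = -1 gives the
  second: one sign \<open>e\<close> serves both directions, reversed on the way back.\<close>

lemma bar_signed:
  obtains e where "e = 1 \<or> e = -1" "p dvd t * x - e * bar x" "p dvd t * bar x + e * x"
proof -
  obtain e where e: "e = 1 \<or> e = -1" "p dvd bar x - e * (t * x)"
    unfolding pbar_def by (rule tilde_signed)
  have ee: "e * e = 1"
    using e(1) by auto
  have "t * x - e * bar x = - e * (bar x - e * (t * x))"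
    using ee by (simp add: algebra_simps)
  then have 1: "p dvd t * x - e * bar x"
    using e(2) by simp
  have "t * bar x + e * x = t * (bar x - e * (t * x)) + (t * t + 1) * (e * x)"
    by (simp add: algebra_simps)
  then have "p dvd t * bar x + e * x"
    using e(2) t_sq by (metis dvd_add dvd_mult dvd_mult2)
  with 1 e(1) show ?thesis
    using that by blast
qed

text \<open>At a fixed point the two congruences of \<open>bar_signed\<close> would give t x = e x
  and t x = - e x modulo \<open>p\<close>, hence p would divide 2x.\<close>

lemma bar_neq:
  assumes "x \<in> {1..n}"
  shows "bar x \<noteq> x"
proof
  assume eq: "bar x = x"
  obtain e where e: "e = 1 \<or> e = -1" "p dvd t * x - e * bar x" "p dvd t * bar x + e * x"
    by (rule bar_signed)
  then have "p dvd 2 * (e * x)"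
    using eq dvd_diff[OF e(3) e(2)] by (simp add: algebra_simps)
  moreover have "\<bar>2 * (e * x)\<bar> < p" "2 * (e * x) \<noteq> 0"
    using e(1) assms p_eq by auto
  ultimately show False
    using dvd_imp_le_int[of "2 * (e * x)" p] p_ge_5 by simp
qed

section \<open>The set \<open>V\<close> of left endpoints and the sum of its elements\<close>

lemma V_eq: "V p = {x \<in> {1..n}. x < bar x}"
  by (auto simp: V_def pbar_def half)

lemma finite_V [simp]: "finite (V p)"
  by (rule finite_subset[of _ "{1..n}"]) (auto simp: V_eq)

lemma bar_inj: "inj_on bar {1..n}"
  by (metis bar_bar inj_onI)

lemma sum_eq_sum_V:
  fixes g :: "int \<Rightarrow> int"
  shows "(\<Sum>x\<in>{1..n}. g x) = (\<Sum>a\<in>V p. g a + g (bar a))"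
proof -
  have "{1..n} = V p \<union> bar ` V p"
  proof (intro equalityI subsetI)
    fix x assume x: "x \<in> {1..n}"
    show "x \<in> V p \<union> bar ` V p"
    proof (cases "x < bar x")
      case False
      then have "bar x \<in> V p"
        using x bar_neq[OF x] bar_in[OF x] bar_bar[OF x] by (simp add: V_eq)
      then show ?thesis
        using bar_bar[OF x] by (metis UnI2 imageI)
    qed (use x in \<open>simp add: V_eq\<close>)
  qed (use bar_in in \<open>auto simp: V_eq\<close>)
  moreover have "V p \<inter> bar ` V p = {}"
    using bar_bar by (force simp: V_eq)
  moreover have "inj_on bar (V p)"
    using bar_inj by (rule inj_on_subset) (auto simp: V_eq)
  ultimately show ?thesis
    by (simp add: sum.union_disjoint sum.reindex sum.distrib)
qed

lemma card_V: "2 * int (card (V p)) = n"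
  using sum_eq_sum_V[of "\<lambda>_. 1"] n_pos by simp

text \<open>
  Multiplication by \<open>t - 1\<close> permutes the orbits of \<open>\<langle>t\<rangle>\<close>; on the representatives in \<open>V\<close> it is
  \<open>a \<mapsto> bar a - a\<close>.
\<close>

lemma bar_diff:
  assumes "a \<in> V p"
  shows "bar (bar a - a) = tilde p (a + bar a)"
proof -
  obtain e where e: "e = 1 \<or> e = -1" "p dvd t * a - e * bar a" "p dvd t * bar a + e * a"
    by (rule bar_signed)
  have "p dvd t * (bar a - a) - (- e * (a + bar a))"
    using dvd_diff[OF e(3) e(2)] by (simp add: algebra_simps)
  then have "bar (bar a - a) = tilde p (- e * (a + bar a))"
    unfolding pbar_def by (rule tilde_cong)
  then show ?thesis
    using e(1) tilde_minus[of "a + bar a"] by auto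
qed

lemma tilde_add_bar:
  assumes "a \<in> V p"
  shows "tilde p (a + bar a) = (if a + bar a \<le> n then a + bar a else p - (a + bar a))"
  using assms bar_in[of a] tilde_small[of "a + bar a"] tilde_large[of "a + bar a"]
  by (auto simp: V_eq)

lemma bij_betw_bar_diff: "bij_betw (\<lambda>a. bar a - a) (V p) (V p)"
proof -
  have "inj_on (\<lambda>a. bar a - a) (V p)"
  proof (rule inj_onI)
    fix a b assume ab: "a \<in> V p" "b \<in> V p" and eq: "bar a - a = bar b - b"
    have "tilde p (a + bar a) = tilde p (b + bar b)"
      using ab eq by (metis bar_diff)
    then have "a + bar a = b + bar b \<or> a + bar a + b + bar b = p"
      unfolding tilde_add_bar[OF ab(1)] tilde_add_bar[OF ab(2)] by (auto split: if_splits)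
    then show "a = b"
    proof
      \<comment> \<open>Impossible by parity: equal differences turn the left side into twice bar a
        + b, while \<open>p\<close> is odd.\<close>
      assume "a + bar a + b + bar b = p"
      with eq have "2 * (bar a + b) = 2 * n + 1"
        using p_eq by simp
      then show ?thesis
        by presburger
    qed (use eq in simp)
  qed
  moreover have "(\<lambda>a. bar a - a) ` V p \<subseteq> V p"
  proof (rule image_subsetI)
    fix a assume a: "a \<in> V p"
    then have "1 \<le> a" "a < bar a" "bar a \<le> n"
      using bar_in[of a] by (auto simp: V_eq)
    \<comment> \<open>Both possible values, a + bar a and p - (a + bar a), exceed bar a - a; for the
      second, 2 bar a \<le> 2 * n < p.\<close>
    moreover from this have "bar a - a < bar (bar a - a)"
      using p_eq unfolding bar_diff[OF a] tilde_add_bar[OF a] by (simp split: if_split)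
    ultimately show "bar a - a \<in> V p"
      by (simp add: V_eq)
  qed
  ultimately show ?thesis
    by (simp add: bij_betw_def endo_inj_surj)
qed

lemma sum_bar: "(\<Sum>a\<in>V p. bar a) = 2 * (\<Sum>a\<in>V p. a)"
  using sum.reindex_bij_betw[OF bij_betw_bar_diff, of "\<lambda>x. x"] by (simp add: sum_subtractf)

lemma sum_V: "6 * (\<Sum>a\<in>V p. a) = n * (n + 1)"
proof -
  have "2 * (\<Sum>x\<in>{1..n}. x) = n * (n + 1)"
    using sum_atLeastAtMost_int[of "nat n"] n_pos by simp
  then show ?thesis
    unfolding sum_eq_sum_V[of "\<lambda>x. x"] by (simp add: sum.distrib sum_bar)
qed

section \<open>Vanishing of the comparison sum over all residues\<close>

lemma sum_sg: "(\<Sum>u\<in>{0..<p}. sg u * sg (t * u)) = 0"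
proof -
  let ?g = "\<lambda>u. sg u * sg (t * u)"
  have "?g (u mod p) = ?g u" for u
    by (metis cres_mod mod_mult_right_eq)
  then have "(\<Sum>u\<in>{0..<p}. ?g (t * u + 0)) = (\<Sum>u\<in>{0..<p}. ?g u)"
    using p_ge_5 coprime_t by (intro sum_residues_affine) auto
  moreover have "?g (t * u + 0) = - ?g u" for u
  proof -
    have "p dvd t * (t * u) - - u"
      using dvd_mult2[OF t_sq, of u] by (simp add: algebra_simps)
    then have "cres p (t * (t * u)) = - cres p u"
      using cres_cong cres_minus by metis
    then show ?thesis
      by simp
  qed
  ultimately show ?thesis
    by (simp add: sum_negf)
qed

lemma cmp_mod: "cmp p (x mod p) y = cmp p x y" "cmp p x (y mod p) = cmp p x y"
  by (simp_all add: cmp_def tilde_mod)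

lemma cmp_minus: "cmp p (- x) y = cmp p x y" "cmp p x (- y) = cmp p x y"
  by (simp_all add: cmp_def)

lemma cmp_mult_mod:
  "cmp p (c * (x mod p)) y = cmp p (c * x) y"
  "cmp p x (c * (y mod p)) = cmp p x (c * y)"
  by (metis cmp_mod(1) mod_mult_right_eq) (metis cmp_mod(2) mod_mult_right_eq)

lemma sum_cmp_residues:
  "(\<Sum>x\<in>{0..<p}. \<Sum>y\<in>{0..<p}. cmp p x y * cmp p (t * x) (t * y)) = 0"
proof -
  let ?R = "{0..<p}" and ?h = "\<lambda>x y. cmp p x y * cmp p (t * x) (t * y)"
  have "coprime 2 p"
    using p_eq by simp
  \<comment> \<open>The rotation is made in two one-variable substitutions: first y = 2u + v, using
    that 2 is invertible, then v is shifted by -u.\<close>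
  have "(\<Sum>x\<in>?R. \<Sum>y\<in>?R. ?h x y) = (\<Sum>v\<in>?R. \<Sum>u\<in>?R. ?h v (2 * u + v))"
    using p_ge_5 \<open>coprime 2 p\<close>
    by (intro sum.cong refl sum_residues_affine[symmetric]) (simp_all add: cmp_mod cmp_mult_mod)
  also have "\<dots> = (\<Sum>u\<in>?R. \<Sum>v\<in>?R. ?h v (2 * u + v))"
    by (rule sum.swap)
  also have "\<dots> = (\<Sum>u\<in>?R. \<Sum>v\<in>?R. ?h (1 * v + - u) (2 * u + (1 * v + - u)))"
  proof (rule sum.cong[OF refl])
    fix u
    have "cmp p a (2 * u + v mod p) = cmp p a (2 * u + v)"
      "cmp p a (t * (2 * u + v mod p)) = cmp p a (t * (2 * u + v))" for a v
      by (metis cmp_mod(2) mod_add_right_eq) (metis cmp_mult_mod(2) mod_add_right_eq)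
    then show "(\<Sum>v\<in>?R. ?h v (2 * u + v)) = (\<Sum>v\<in>?R. ?h (1 * v + - u) (2 * u + (1 * v + - u)))"
      using p_ge_5 by (intro sum_residues_affine[where c = 1, symmetric])
        (simp_all add: cmp_mod cmp_mult_mod)
  qed
  \<comment> \<open>Applied to (u, v) and to (t u, t v), \<open>cmp_diff_add\<close> separates the
    variables.\<close>
  also have "\<dots> = (\<Sum>u\<in>?R. \<Sum>v\<in>?R. (sg u * sg (t * u)) * (sg v * sg (t * v)))"
  proof (intro sum.cong refl)
    fix u v
    have "1 * v + - u = v - u" "2 * u + (1 * v + - u) = v + u"
      "t * (v - u) = t * v - t * u" "t * (v + u) = t * v + t * u"
      by (simp_all add: algebra_simps)
    then show "?h (1 * v + - u) (2 * u + (1 * v + - u)) = (sg u * sg (t * u)) * (sg v * sg (t * v))"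
      by (simp only: cmp_diff_add mult_ac)
  qed
  also have "\<dots> = 0"
    by (simp only: sum_distrib_left[symmetric] sum_sg) simp
  finally show ?thesis .
qed

section \<open>Evaluation of the two sign sums over 1, ..., n\<close>

lemma cmp_eq:
  assumes "x \<in> {1..n}" "y \<in> {1..n}"
  shows "cmp p x y = sgn (y - x)" "cmp p (t * x) (t * y) = sgn (bar y - bar x)"
  using assms by (auto simp: cmp_def pbar_def tilde_small)

lemma sum_sgn_bar:
  "(\<Sum>x\<in>{1..n}. \<Sum>y\<in>{1..n}. sgn (y - x) * sgn (bar y - bar x)) = - n"
proof -
  let ?I = "{1..n}" and ?h = "\<lambda>x y. cmp p x y * cmp p (t * x) (t * y)"
  have fold: "(\<Sum>y\<in>{0..<p}. ?h x y) = ?h x 0 + 2 * (\<Sum>y\<in>?I. ?h x y)" for x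
    by (rule sum_residues_even) (simp_all add: cmp_mod cmp_mult_mod cmp_minus)
  have tilde_pos: "0 < tilde p x \<and> 0 < tilde p (t * x)" if "x \<in> ?I" for x
    using that bar_in[OF that] by (simp add: pbar_def tilde_small)
  have zero: "tilde p 0 = 0"
    using n_pos by (simp add: tilde_small)
  \<comment> \<open>On the axes both factors compare with 0 in the same direction, so their product
    is 1 away from the origin. Folding both variables then gives 0 = 4n + 4S, with S the sum over 1,
    ..., n.\<close>
  have h0: "?h 0 0 = 0" "\<And>x. x \<in> ?I \<Longrightarrow> ?h x 0 = 1" "\<And>x. x \<in> ?I \<Longrightarrow> ?h 0 x = 1"
    using tilde_pos by (auto simp: cmp_def zero)
  have "0 = (\<Sum>x\<in>{0..<p}. ?h x 0 + 2 * (\<Sum>y\<in>?I. ?h x y))"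
    using sum_cmp_residues by (simp add: fold)
  also have "\<dots> = (?h 0 0 + 2 * (\<Sum>y\<in>?I. ?h 0 y)) + 2 * (\<Sum>x\<in>?I. ?h x 0 + 2 * (\<Sum>y\<in>?I. ?h x y))"
    by (rule sum_residues_even) (simp_all add: cmp_mod cmp_mult_mod cmp_minus)
  also have "\<dots> = (2 * (\<Sum>y\<in>?I. 1)) + 2 * (\<Sum>x\<in>?I. 1 + 2 * (\<Sum>y\<in>?I. ?h x y))"
    using h0 by (simp only: cong: sum.cong)
  also have "\<dots> = 4 * n + 4 * (\<Sum>x\<in>?I. \<Sum>y\<in>?I. ?h x y)"
    using n_pos by (simp add: sum.distrib sum_distrib_left)
  finally have "(\<Sum>x\<in>?I. \<Sum>y\<in>?I. ?h x y) = - n"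
    by linarith
  moreover have "(\<Sum>x\<in>?I. \<Sum>y\<in>?I. ?h x y) = (\<Sum>x\<in>?I. \<Sum>y\<in>?I. sgn (y - x) * sgn (bar y - bar x))"
    by (intro sum.cong refl) (simp add: cmp_eq)
  ultimately show ?thesis
    by simp
qed

lemma sum_sgn_separated:
  "3 * (\<Sum>x\<in>{1..n}. \<Sum>y\<in>{1..n}. sgn (y - x) * sgn (y - bar x)) = n * (n - 2)"
proof -
  have inner: "(\<Sum>y\<in>{1..n}. sgn (y - x) * sgn (y - bar x)) = n - 2 * \<bar>bar x - x\<bar>"
    if "x \<in> {1..n}" for x
  proof (cases "x < bar x")
    case True
    then show ?thesis
      using sum_sgn_mult_sgn[of x "bar x" n] that bar_in[OF that] by simp
  next
    case False
    then have "bar x < x"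
      using bar_neq[OF that] by simp
    then show ?thesis
      using sum_sgn_mult_sgn[of "bar x" x n] that bar_in[OF that] by (simp add: mult.commute)
  qed
  \<comment> \<open>Each chord length is counted once from either endpoint.\<close>
  have "(\<Sum>x\<in>{1..n}. \<bar>bar x - x\<bar>) = (\<Sum>a\<in>V p. 2 * (bar a - a))"
    unfolding sum_eq_sum_V by (intro sum.cong refl) (auto simp: V_eq bar_bar)
  also have "\<dots> = 2 * (\<Sum>a\<in>V p. a)"
    by (simp add: sum_distrib_left[symmetric] sum_subtractf sum_bar)
  finally have "3 * (\<Sum>x\<in>{1..n}. \<bar>bar x - x\<bar>) = n * (n + 1)"
    using sum_V by simp
  moreover have "(\<Sum>x\<in>{1..n}. \<Sum>y\<in>{1..n}. sgn (y - x) * sgn (y - bar x))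
      = n * n - 2 * (\<Sum>x\<in>{1..n}. \<bar>bar x - x\<bar>)"
    using n_pos by (simp add: inner sum_subtractf sum_distrib_left)
  ultimately show ?thesis
    by (simp add: algebra_simps)
qed

section \<open>Counting crossing, disjoint and nested pairs of chords\<close>

lemma finite_XYZ: "finite (X p)" "finite (Y p)" "finite (Z p)"
  by (rule finite_subset[of _ "V p \<times> V p"]; auto simp: X_def Y_def Z_def)+

text \<open>Pairing (a, b) with (b, a) reduces to a < b. All four endpoints are then distinct, and
  comparing bar a with b and bar b decides among \<open>X\<close>, \<open>Y\<close> and
  \<open>Z\<close>.\<close>

lemma sum_V_pairs:
  fixes F :: "int \<Rightarrow> int \<Rightarrow> int"
  assumes FX: "\<And>a b. (a, b) \<in> X p \<Longrightarrow> F a b + F b a = cX"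
    and FY: "\<And>a b. (a, b) \<in> Y p \<Longrightarrow> F a b + F b a = cY"
    and FZ: "\<And>a b. (a, b) \<in> Z p \<Longrightarrow> F a b + F b a = cZ"
  shows "(\<Sum>a\<in>V p. \<Sum>b\<in>V p. F a b)
    = (\<Sum>a\<in>V p. F a a) + cX * int (card (X p)) + cY * int (card (Y p)) + cZ * int (card (Z p))"
proof -
  let ?V = "V p" and ?F = "\<lambda>(a, b). F a b" and ?G = "\<lambda>(a, b). F a b + F b a"
  define D L U where "D = {(a, b) \<in> ?V \<times> ?V. a = b}"
    and "L = {(a, b) \<in> ?V \<times> ?V. a < b}" and "U = {(a, b) \<in> ?V \<times> ?V. b < a}"
  have fin: "finite D" "finite L" "finite U"
    by (rule finite_subset[of _ "?V \<times> ?V"]; auto simp: D_def L_def U_def)+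
  have "(\<Sum>a\<in>?V. \<Sum>b\<in>?V. F a b) = sum ?F (?V \<times> ?V)"
    by (simp add: sum.cartesian_product)
  also have "?V \<times> ?V = D \<union> L \<union> U"
    by (auto simp: D_def L_def U_def)
  also have "sum ?F (D \<union> L \<union> U) = sum ?F D + sum ?F L + sum ?F U"
    using fin by (subst sum.union_disjoint; (auto simp: D_def L_def U_def)?)+
  also have "sum ?F D = (\<Sum>a\<in>?V. F a a)"
    by (rule sum.reindex_bij_witness[where i = "\<lambda>a. (a, a)" and j = fst]) (auto simp: D_def)
  also have "sum ?F U = (\<Sum>(a, b)\<in>L. F b a)"
    by (rule sum.reindex_bij_witness[where i = prod.swap and j = prod.swap])
      (auto simp: L_def U_def)
  finally have "(\<Sum>a\<in>?V. \<Sum>b\<in>?V. F a b) = (\<Sum>a\<in>?V. F a a) + sum ?G L"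
    by (simp add: sum.distrib case_prod_unfold)
  moreover have "L = X p \<union> Y p \<union> Z p"
  proof -
    have "bar a \<noteq> bar b" "b \<noteq> bar a" if "a \<in> ?V" "b \<in> ?V" "a < b" for a b
      using that bar_bar[of a] bar_bar[of b] by (auto simp: V_eq)
    then have "(a, b) \<in> L \<longleftrightarrow> (a, b) \<in> X p \<union> Y p \<union> Z p" for a b
      unfolding L_def X_def Y_def Z_def V_eq by (auto simp: neq_iff)
    then show ?thesis
      by auto
  qed
  moreover have "sum ?G (X p \<union> Y p \<union> Z p) = sum ?G (X p) + sum ?G (Y p) + sum ?G (Z p)"
    using finite_XYZ
    by (subst sum.union_disjoint; (auto simp: X_def Y_def Z_def)?)+
  moreover have "sum ?G (X p) = sum (\<lambda>_. cX) (X p)" "sum ?G (Y p) = sum (\<lambda>_. cY) (Y p)"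
    "sum ?G (Z p) = sum (\<lambda>_. cZ) (Z p)"
    using FX FY FZ by (intro sum.cong; auto)+
  ultimately show ?thesis
    by (simp add: mult.commute)
qed

lemma sum_sum_eq_sum_V:
  fixes g :: "int \<Rightarrow> int \<Rightarrow> int"
  shows "(\<Sum>x\<in>{1..n}. \<Sum>y\<in>{1..n}. g x y)
    = (\<Sum>a\<in>V p. \<Sum>b\<in>V p. g a b + g a (bar b) + g (bar a) b + g (bar a) (bar b))"
  unfolding sum_eq_sum_V by (simp add: sum.distrib algebra_simps)

lemma V_bar_bar: "a \<in> V p \<Longrightarrow> bar (bar a) = a"
  by (simp add: V_eq bar_bar)

lemma card_Y_eq_card_Z: "card (Y p) = card (Z p)"
proof -
  let ?g = "\<lambda>x y. sgn (y - x) * sgn (bar y - bar x)"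
  let ?F = "\<lambda>a b. ?g a b + ?g a (bar b) + ?g (bar a) b + ?g (bar a) (bar b)"
  \<comment> \<open>Swapping the ends of both chords keeps all eight signs 1 for disjoint chords and
    -1 for nested ones; for crossing chords they cancel. The diagonal adds -2 per chord, in total
    -n, which is the whole sum.\<close>
  have "(\<Sum>a\<in>V p. \<Sum>b\<in>V p. ?F a b)
    = (\<Sum>a\<in>V p. ?F a a) + 0 * int (card (X p)) + 8 * int (card (Y p)) + (-8) * int (card (Z p))"
    by (rule sum_V_pairs) (auto simp: X_def Y_def Z_def V_bar_bar sgn_if)
  moreover have "(\<Sum>a\<in>V p. ?F a a) = (\<Sum>a\<in>V p. -2)"
    by (intro sum.cong refl) (auto simp: V_eq bar_bar)
  ultimately have "8 * int (card (Y p)) = 8 * int (card (Z p))"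
    using sum_sgn_bar card_V by (simp add: sum_sum_eq_sum_V)
  then show ?thesis
    by simp
qed

lemma card_Y: "24 * int (card (Y p)) = n * (n - 2)"
proof -
  let ?g = "\<lambda>x y. sgn (y - x) * sgn (y - bar x)"
  let ?F = "\<lambda>a b. ?g a b + ?g a (bar b) + ?g (bar a) b + ?g (bar a) (bar b)"
  \<comment> \<open>A term is 1 if \<open>y\<close> lies outside the chord of \<open>x\<close> and
    -1 if inside. Crossing chords have one end inside each other; for nested ones the -4 of the
    outer chord cancels the 4 of the inner.\<close>
  have "(\<Sum>a\<in>V p. \<Sum>b\<in>V p. ?F a b)
    = (\<Sum>a\<in>V p. ?F a a) + 0 * int (card (X p)) + 8 * int (card (Y p)) + 0 * int (card (Z p))"
    by (rule sum_V_pairs) (auto simp: X_def Y_def Z_def V_bar_bar sgn_if)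
  moreover have "(\<Sum>a\<in>V p. ?F a a) = (\<Sum>a\<in>V p. 0)"
    by (intro sum.cong refl) (auto simp: V_bar_bar)
  ultimately show ?thesis
    using sum_sgn_separated by (simp add: sum_sum_eq_sum_V)
qed

lemma card_XYZ: "8 * int (card (X p) + card (Y p) + card (Z p)) = n * (n - 2)"
proof -
  have "(\<Sum>a\<in>V p. \<Sum>b\<in>V p. 1)
    = (\<Sum>a\<in>V p. 1) + 2 * int (card (X p)) + 2 * int (card (Y p)) + 2 * int (card (Z p))"
    by (rule sum_V_pairs) auto
  then have "2 * int (card (X p) + card (Y p) + card (Z p))
      = int (card (V p)) * (int (card (V p)) - 1)"
    by (simp add: algebra_simps)
  then show ?thesis
    unfolding card_V[symmetric] by (simp add: algebra_simps)
qed

end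

theorem theorem3p5:
  fixes p :: int
  assumes "prime p" and "[p = 1] (mod 4)"
  shows "card (X p) = card (Y p) \<and> card (Y p) = card (Z p) \<and>
    real (card (Z p)) = (real_of_int p - 1) * (real_of_int p - 5) / 96"
proof -
  define n where "n = (p - 1) div 2"
  have "1 < p"
    using assms(1) by (rule prime_gt_1_int)
  moreover have "p mod 4 = 1"
    using assms(2) by (simp add: cong_def)
  ultimately have n: "p = 2 * n + 1" "0 < n" "even n"
    unfolding n_def by presburger+
  then interpret prime_1_mod_4 p n
    using assms(1) by unfold_locales
  have YZ: "card (Y p) = card (Z p)"
    by (rule card_Y_eq_card_Z)
  moreover have "card (X p) = card (Y p)"
    \<comment> \<open>Together |X| + |Y| + |Z| = 3 |Y|, and |Y| = |Z|.\<close>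
    using card_Y card_XYZ YZ by simp
  moreover have "24 * real (card (Z p)) = real_of_int n * (real_of_int n - 2)"
    using arg_cong[OF card_Y, of real_of_int] YZ by simp
  then have "real (card (Z p)) = (real_of_int p - 1) * (real_of_int p - 5) / 96"
    using n(1) by (simp add: field_simps)
  ultimately show ?thesis
    by blast
qed

end
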